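(* Let $X$ be a reflexive Banach space and let $F\subseteq X$ be a closed convex set with $0\in\mathrm{int}\,F$. Suppose $\Omega$ and $\Omega_i$, $i=1,\ldots,m$, are nonempty closed bounded convex subsets of $X$ and $$\Omega\cap\Big[\bigcap_{i=1}^m(\Omega_i-F_\infty)\Big]=\emptyset.$$ Let $\mathcal{T}(x)=\max\{\mathcal{T}^F_{\Omega_i}(x): i=1,\ldots,m\}$. Then $\bar x\in\Omega$ is an optimal solution of the optimization problem $$\text{minimize } \mathcal{T}(x)\ \text{ subject to } x\in\Omega$$ with $r=\mathcal{T}(\bar x)$ if and only if $\bar x$ is an optimal solution of the smallest intersecting ball problem (SIB) with the smallest radius $r$.
   Context: Normed spaces are real. For $t\ge 0$, $tF=\{tf: f\in F\}$ (so $0F=\{0\}$), and $\inf\emptyset=\infty$. For nonempty $Q\subseteq X$, the minimal time function is $\mathcal{T}^F_Q(x)=\inf\{t\ge 0: (x+tF)\cap Q\ne\emptyset\}\in[0,\infty]$. The asymptotic cone of $F$ is $F_\infty=\{d\in X: x+td\in F \text{ for all } t>0\}$, where $x\in F$ is any point (the set does not depend on the choice of $x\in F$). Definition: $\bar x\in\Omega$ is a (an optimal) solution of the smallest intersecting ball problem (SIB) with the smallest radius $r$ if $r\in[0,\infty)$, $(\bar x+rF)\cap\Omega_i\ne\emptyset$ for all $i=1,\ldots,m$, and whenever $x\in\Omega$ and $r'\in[0,\infty)$ satisfy $(x+r'F)\cap\Omega_i\ne\emptyset$ for all $i=1,\ldots,m$, then $r\le r'$. *)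

theory Defs
  imports "HOL-Analysis.Analysis"
begin

text \<open>The canonical map of a normed space into its bidual, \<open>x \<mapsto> (f \<mapsto> f x)\<close>.\<close>

definition bidual_embedding ::
    "'a::real_normed_vector \<Rightarrow> ('a \<Rightarrow>\<^sub>L real) \<Rightarrow>\<^sub>L real" where
  "bidual_embedding x = blinfun.prod_left x"

lemma blinfun_apply_bidual_embedding:
  "blinfun_apply (bidual_embedding x) f = blinfun_apply f x"
  by (simp add: bidual_embedding_def blinfun.prod_left.rep_eq)

definition reflexive_space :: "'a::real_normed_vector itself \<Rightarrow> bool" where
  "reflexive_space _ \<longleftrightarrow> surj (bidual_embedding :: 'a \<Rightarrow> ('a \<Rightarrow>\<^sub>L real) \<Rightarrow>\<^sub>L real)"

text \<open>The generalized ball \<open>x + t F\<close>.\<close>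

definition gball :: "'a::real_vector set \<Rightarrow> 'a \<Rightarrow> real \<Rightarrow> 'a set" where
  "gball F x t = (\<lambda>f. x + t *\<^sub>R f) ` F"

text \<open>In \<^typ>\<open>ereal\<close> the infimum of the empty set is \<open>\<infinity>\<close>.\<close>

definition minimal_time :: "'a::real_vector set \<Rightarrow> 'a set \<Rightarrow> 'a \<Rightarrow> ereal" where
  "minimal_time F Q x = Inf {ereal t | t. 0 \<le> t \<and> gball F x t \<inter> Q \<noteq> {}}"

text \<open>The base point \<open>x\<close> is immaterial for closed convex \<open>F\<close>; see \<open>asymptotic_cone_eq\<close>.\<close>

definition asymptotic_cone :: "'a::real_vector set \<Rightarrow> 'a set" where
  "asymptotic_cone F = {d. \<exists>x\<in>F. \<forall>t>0. x + t *\<^sub>R d \<in> F}"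

lemma asymptotic_cone_eq:
  fixes F :: "'a::real_normed_vector set"
  assumes F: "closed F" "convex F" and "y \<in> F"
  shows "asymptotic_cone F = {d. \<forall>t>0. y + t *\<^sub>R d \<in> F}"
proof (intro equalityI subsetI CollectI allI impI)
  fix d t assume "d \<in> asymptotic_cone F" and t: "(t::real) > 0"
  then obtain x where x: "\<And>s. s > 0 \<Longrightarrow> x + s *\<^sub>R d \<in> F"
    by (auto simp: asymptotic_cone_def)
  define e where "e n = inverse (real (Suc n))" for n
  define z where "z n = (1 - e n) *\<^sub>R y + e n *\<^sub>R (x + (t / e n) *\<^sub>R d)" for n
  have e: "0 < e n" "e n \<le> 1" for n
    by (auto simp: e_def field_simps)
  have "z n \<in> F" for n
    unfolding z_def using e[of n] t \<open>y \<in> F\<close> x[of "t / e n"]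
    by (intro convexD[OF F(2)]) auto
  moreover have z_eq: "z = (\<lambda>n. (1 - e n) *\<^sub>R y + e n *\<^sub>R x + t *\<^sub>R d)"
  proof
    show "z n = (1 - e n) *\<^sub>R y + e n *\<^sub>R x + t *\<^sub>R d" for n
      using e(1)[of n] by (simp add: z_def scaleR_add_right)
  qed
  moreover have "e \<longlonglongrightarrow> 0"
    unfolding e_def by (rule LIMSEQ_inverse_real_of_nat)
  then have "z \<longlonglongrightarrow> (1 - 0) *\<^sub>R y + 0 *\<^sub>R x + t *\<^sub>R d"
    unfolding z_eq by (intro tendsto_intros)
  ultimately show "y + t *\<^sub>R d \<in> F"
    using closed_sequentially[OF F(1), of z "y + t *\<^sub>R d"] by auto
next
  fix d assume "d \<in> {d. \<forall>t>0. y + t *\<^sub>R d \<in> F}"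
  then show "d \<in> asymptotic_cone F"
    using \<open>y \<in> F\<close> by (auto simp: asymptotic_cone_def)
qed

definition max_time ::
    "'a::real_vector set \<Rightarrow> nat \<Rightarrow> (nat \<Rightarrow> 'a set) \<Rightarrow> 'a \<Rightarrow> ereal" where
  "max_time F m \<Omega>s x = (MAX i\<in>{1..m}. minimal_time F (\<Omega>s i) x)"

definition sib_solution ::
    "'a::real_vector set \<Rightarrow> 'a set \<Rightarrow> nat \<Rightarrow> (nat \<Rightarrow> 'a set) \<Rightarrow> 'a \<Rightarrow> real \<Rightarrow> bool" where
  "sib_solution F \<Omega> m \<Omega>s x r \<longleftrightarrow>
     x \<in> \<Omega> \<and> 0 \<le> r \<and> (\<forall>i\<in>{1..m}. gball F x r \<inter> \<Omega>s i \<noteq> {}) \<and>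
     (\<forall>y\<in>\<Omega>. \<forall>r'\<ge>0. (\<forall>i\<in>{1..m}. gball F y r' \<inter> \<Omega>s i \<noteq> {}) \<longrightarrow> r \<le> r')"

end

theory Submission
  imports Defs
begin

text \<open>
  Since \<open>0 \<in> F\<close>, the sets \<open>{w \<in> \<Omega>\<^sub>i. (w - x) / t \<in> F}\<close> shrink as \<open>t\<close> decreases. In a reflexive space a
  chain of nonempty closed bounded convex sets has a common point, so for \<open>T x = r\<close> some
  \<open>w \<in> \<Omega>\<^sub>i\<close> satisfies \<open>(w - x) / t \<in> F\<close> for all \<open>t > r\<close>. If \<open>r > 0\<close>, closedness of \<open>F\<close> shows that the
  infimum defining the minimal time is attained; if \<open>r = 0\<close>, then \<open>w - x\<close> lies in the asymptotic
  cone, which the hypothesis excludes. Hence \<open>T x \<le> r\<close> holds exactly when all the generalized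
  balls \<open>x + r F\<close> meet their targets.

  The intersection property is obtained from Zorn's lemma: minimal sublinear functionals are linear,
  so there is a linear functional on the dual below the support functions of all sets of the
  chain. By reflexivity it is evaluation at a point, and separation places this point in every set.
\<close>

section \<open>Sublinear functionals\<close>

text \<open>Homogeneity is asked for \<open>t > 0\<close> only; the value at 0 is then forced to be
  0 by scaling with 2.\<close>

definition sublinear :: "('a::real_vector \<Rightarrow> real) \<Rightarrow> bool" where
  "sublinear p \<longleftrightarrow>
     (\<forall>x y. p (x + y) \<le> p x + p y) \<and> (\<forall>t>0. \<forall>x. p (t *\<^sub>R x) = t * p x)"

text \<open>One inequality for scaling suffices: applied to \<open>inverse t\<close> and the vector
  \<open>t *\<^sub>R x\<close>, it gives the reverse one.\<close>

lemma sublinearI: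
  assumes add: "\<And>x y. p (x + y) \<le> p x + p y"
    and scale: "\<And>t x. t > 0 \<Longrightarrow> p (t *\<^sub>R x) \<le> t * p x"
  shows "sublinear p"
  unfolding sublinear_def
proof (intro conjI allI impI antisym add scale)
  fix t :: real and x assume t: "t > 0"
  have "p (inverse t *\<^sub>R (t *\<^sub>R x)) \<le> inverse t * p (t *\<^sub>R x)"
    using t by (intro scale) simp
  then show "t * p x \<le> p (t *\<^sub>R x)"
    using t by (simp add: field_simps)
qed auto

lemma sublinear_add: "sublinear p \<Longrightarrow> p (x + y) \<le> p x + p y"
  and sublinear_scale: "sublinear p \<Longrightarrow> t > 0 \<Longrightarrow> p (t *\<^sub>R x) = t * p x"
  by (auto simp: sublinear_def)

lemma sublinear_zero:
  assumes "sublinear p"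
  shows "p 0 = 0"
  using sublinear_scale[OF assms, of 2 0] by simp

lemma sublinear_scale_nonneg:
  assumes "sublinear p" "t \<ge> 0"
  shows "p (t *\<^sub>R x) = t * p x"
  using assms by (cases "t = 0") (simp_all add: sublinear_zero sublinear_scale)

lemma sublinear_minus:
  assumes "sublinear p"
  shows "- p (- x) \<le> p x"
  using sublinear_add[OF assms, of x "- x"] sublinear_zero[OF assms] by simp

text \<open>Subadditivity at \<open>x + y\<close> and \<open>- y\<close>, combined with oddness,
  reverses the inequality for sums; oddness also carries homogeneity to negative scalars.\<close>

lemma sublinear_odd_imp_linear:
  assumes p: "sublinear p" and odd: "\<And>x. p (- x) = - p x"
  shows "linear p"
proof (rule linearI)
  fix x y
  show "p (x + y) = p x + p y"
    using sublinear_add[OF p, of x y] sublinear_add[OF p, of "x + y" "- y"] odd[of y] by simp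
next
  fix t x
  show "p (t *\<^sub>R x) = t *\<^sub>R p x"
  proof (cases "t \<ge> 0")
    case True
    then show ?thesis by (simp add: sublinear_scale_nonneg[OF p])
  next
    case False
    then show ?thesis
      using sublinear_scale[OF p, of "- t" x] odd[of "t *\<^sub>R x"] by simp
  qed
qed

text \<open>The infimal convolution with a penalty along \<open>C\<close>, as in the Mazur--Orlicz theorem.\<close>

lemma sublinear_minorant_exists:
  assumes P: "sublinear P" and C: "convex C" "C \<noteq> {}"
    and d: "\<And>c. c \<in> C \<Longrightarrow> d \<le> P c"
  obtains q where "sublinear q" "q \<le> P" "\<And>c. c \<in> C \<Longrightarrow> q (- c) \<le> - d"
proof -
  define A where "A = {0::real..} \<times> C"
  \<comment> \<open>A pair \<open>(s, c)\<close> stands for moving from \<open>y\<close> by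
    \<open>s *\<^sub>R c\<close> in exchange for the reward \<open>s * d\<close>; \<open>q\<close>
    takes the cheapest such move.\<close>
  define g where "g y z = P (y + fst z *\<^sub>R snd z) - fst z * d" for y z
  define q where "q y = (INF z\<in>A. g y z)" for y
  have A: "A \<noteq> {}"
    using C by (auto simp: A_def)
  \<comment> \<open>A lower bound independent of \<open>z\<close> makes the real infimum
    \<open>q y\<close> meaningful; it comes from \<open>d \<le> P c\<close> on
    \<open>C\<close>.\<close>
  have lower: "- P (- y) \<le> g y z" if "z \<in> A" for y z
  proof -
    have "fst z * d \<le> fst z * P (snd z)"
      using that d by (intro mult_left_mono) (auto simp: A_def)
    also have "\<dots> = P (fst z *\<^sub>R snd z)"
      using that by (simp add: A_def sublinear_scale_nonneg[OF P] mem_Times_iff)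
    also have "\<dots> \<le> P (y + fst z *\<^sub>R snd z) + P (- y)"
      using sublinear_add[OF P, of "y + fst z *\<^sub>R snd z" "- y"] by simp
    finally show ?thesis
      by (simp add: g_def)
  qed
  have bdd: "bdd_below (g y ` A)" for y
    using lower by (auto intro!: bdd_belowI2)
  have q_le: "q y \<le> g y z" if "z \<in> A" for y z
    unfolding q_def using bdd that by (rule cINF_lower)
  have q_ge: "u \<le> q y" if "\<And>z. z \<in> A \<Longrightarrow> u \<le> g y z" for u y
    unfolding q_def using A that by (rule cINF_greatest)
  \<comment> \<open>Two moves merge into one of weight \<open>s + s'\<close> whose direction is a
    convex combination in \<open>C\<close>. If both weights vanish, any point of \<open>C\<close>
    serves.\<close>
  have combine: "q (a + b) \<le> g a z + g b z'" if z: "z \<in> A" "z' \<in> A" for a b z z'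
  proof -
    obtain s c s' c' where sc: "z = (s, c)" "z' = (s', c')" "s \<ge> 0" "s' \<ge> 0" "c \<in> C" "c' \<in> C"
      using z by (auto simp: A_def)
    have "\<exists>w\<in>A. fst w = s + s' \<and> fst w *\<^sub>R snd w = s *\<^sub>R c + s' *\<^sub>R c'"
    proof (cases "s + s' = 0")
      case True
      then have "s = 0" "s' = 0"
        using sc by linarith+
      then show ?thesis
        using sc by (intro bexI[of _ "(0, c)"]) (auto simp: A_def)
    next
      case False
      let ?c = "(s / (s + s')) *\<^sub>R c + (s' / (s + s')) *\<^sub>R c'"
      have "?c \<in> C"
        using sc False by (intro convexD[OF C(1)]) (auto simp: add_divide_distrib[symmetric])
      then show ?thesis
        using sc False by (intro bexI[of _ "(s + s', ?c)"]) (auto simp: A_def scaleR_add_right)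
    qed
    then obtain w where w: "w \<in> A" "fst w = s + s'" "fst w *\<^sub>R snd w = s *\<^sub>R c + s' *\<^sub>R c'"
      by blast
    have "q (a + b) \<le> P ((a + b) + (s *\<^sub>R c + s' *\<^sub>R c')) - (s + s') * d"
      using q_le[OF w(1), of "a + b"] unfolding g_def w(3) unfolding w(2) .
    also have "\<dots> = P ((a + s *\<^sub>R c) + (b + s' *\<^sub>R c')) - s * d - s' * d"
      by (simp add: algebra_simps)
    also have "\<dots> \<le> g a z + g b z'"
      using sublinear_add[OF P, of "a + s *\<^sub>R c" "b + s' *\<^sub>R c'"] by (simp add: g_def sc)
    finally show ?thesis .
  qed
  have "sublinear q"
  proof (rule sublinearI)
    fix a b
    \<comment> \<open>The infimum is taken in one summand at a time: first over the moves from
      \<open>b\<close>, then over those from \<open>a\<close>.\<close>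
    have "q (a + b) - g a z \<le> q b" if "z \<in> A" for z
      using combine that by (intro q_ge) (simp add: algebra_simps)
    then have "q (a + b) - q b \<le> q a"
      by (intro q_ge) (simp add: algebra_simps)
    then show "q (a + b) \<le> q a + q b"
      by simp
  next
    fix t :: real and y assume t: "t > 0"
    have "q (t *\<^sub>R y) / t \<le> q y"
    proof (rule q_ge)
      fix z assume z: "z \<in> A"
      \<comment> \<open>The weight is scaled along with \<open>y\<close>, so that \<open>t\<close>
        factors out of the penalized value.\<close>
      have "q (t *\<^sub>R y) \<le> g (t *\<^sub>R y) (t * fst z, snd z)"
        using z t by (intro q_le) (auto simp: A_def)
      also have "\<dots> = P (t *\<^sub>R (y + fst z *\<^sub>R snd z)) - t * (fst z * d)"
        by (simp add: g_def scaleR_add_right)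
      also have "\<dots> = t * g y z"
        unfolding sublinear_scale[OF P t] by (simp add: g_def right_diff_distrib)
      finally show "q (t *\<^sub>R y) / t \<le> g y z"
        using t by (simp add: field_simps)
    qed
    then show "q (t *\<^sub>R y) \<le> t * q y"
      using t by (simp add: field_simps)
  qed
  moreover have "q \<le> P"
  proof (rule le_funI)
    fix y
    obtain c where "c \<in> C"
      using C by blast
    then show "q y \<le> P y"
      using q_le[of "(0, c)" y] by (simp add: A_def g_def)
  qed
  \<comment> \<open>The move of weight 1 along \<open>c\<close> takes \<open>- c\<close> to 0,
    leaving only the reward.\<close>
  moreover have "q (- c) \<le> - d" if "c \<in> C" for c
    using q_le[of "(1, c)" "- c"] that by (simp add: A_def g_def sublinear_zero[OF P])
  ultimately show ?thesis
    using that by blast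
qed

section \<open>Linear minorants from minimal sublinear functionals\<close>

lemma minimal_sublinear_imp_linear:
  assumes p: "sublinear p" and minimal: "\<And>q. sublinear q \<Longrightarrow> q \<le> p \<Longrightarrow> q = p"
  shows "linear p"
proof (rule sublinear_odd_imp_linear[OF p])
  fix x
  \<comment> \<open>With \<open>C = {x}\<close> and \<open>d = p x\<close> the minorant satisfies
    \<open>q (- x) \<le> - p x\<close>; minimality identifies it with \<open>p\<close>, which makes
    \<open>p\<close> odd.\<close>
  obtain q where q: "sublinear q" "q \<le> p" "\<And>c. c \<in> {x} \<Longrightarrow> q (- c) \<le> - p x"
    by (rule sublinear_minorant_exists[OF p, of "{x}" "p x"]) auto
  then have "p (- x) \<le> - p x"
    using minimal[OF q(1,2)] by auto
  then show "p (- x) = - p x"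
    using sublinear_minus[OF p, of x] by linarith
qed

text \<open>The pointwise infimum works. Subadditivity survives because, of any two members of a
  chain, the smaller one can be used for both summands.\<close>

lemma sublinear_chain_lower_bound:
  assumes S: "S \<noteq> {}" "\<And>h. h \<in> S \<Longrightarrow> sublinear h"
    and chain: "\<And>h k. h \<in> S \<Longrightarrow> k \<in> S \<Longrightarrow> h \<le> k \<or> k \<le> h"
  obtains q where "sublinear q" "\<And>h. h \<in> S \<Longrightarrow> q \<le> h"
proof -
  define q where "q y = (INF h\<in>S. h y)" for y
  obtain p where p: "p \<in> S"
    using S by blast
  \<comment> \<open>One fixed member \<open>p\<close> bounds all others from below: if
    \<open>h \<le> p\<close>, via \<open>- h (- y) \<le> h y\<close>; if \<open>p \<le> h\<close>,
    via \<open>- p (- y) \<le> p y\<close>.\<close>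
  have "- p (- y) \<le> h y" if "h \<in> S" for h y
    using chain[OF that p] sublinear_minus[OF S(2)[OF that], of y]
      sublinear_minus[OF S(2)[OF p], of y] le_funD[of h p "- y"] le_funD[of p h y] by linarith
  then have bdd: "bdd_below ((\<lambda>h. h y) ` S)" for y
    by (auto intro!: bdd_belowI2)
  have q_le: "q y \<le> h y" if "h \<in> S" for h y
    unfolding q_def using bdd that by (rule cINF_lower)
  have q_ge: "u \<le> q y" if "\<And>h. h \<in> S \<Longrightarrow> u \<le> h y" for u y
    unfolding q_def using S(1) that by (rule cINF_greatest)
  have "sublinear q"
  proof (rule sublinearI)
    fix a b
    have combine: "q (a + b) \<le> h a + k b" if hk: "h \<in> S" "k \<in> S" for h k
    proof -
      obtain l where l: "l \<in> S" "l \<le> h" "l \<le> k"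
        using chain[OF hk] hk by auto
      then show ?thesis
        using q_le[OF l(1), of "a + b"] sublinear_add[OF S(2)[OF l(1)], of a b]
          le_funD[OF l(2), of a] le_funD[OF l(3), of b] by linarith
    qed
    have "q (a + b) - h a \<le> q b" if "h \<in> S" for h
      using combine[OF that] by (intro q_ge) (simp add: diff_le_eq add.commute)
    then have "q (a + b) - q b \<le> q a"
      by (intro q_ge) (simp add: algebra_simps)
    then show "q (a + b) \<le> q a + q b"
      by simp
  next
    fix t :: real and y assume t: "t > 0"
    have "q (t *\<^sub>R y) / t \<le> q y"
      using q_le sublinear_scale[OF S(2) t] t by (intro q_ge) (fastforce simp: field_simps)
    then show "q (t *\<^sub>R y) \<le> t * q y"
      using t by (simp add: field_simps)
  qed
  then show ?thesis
    using that q_le by (auto simp: le_fun_def)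
qed

lemma linear_minorant_exists:
  assumes p: "sublinear p"
  obtains \<phi> where "linear \<phi>" "\<phi> \<le> p"
proof -
  let ?A = "{h. sublinear h \<and> h \<le> p}"
  \<comment> \<open>The order is reversed because Zorn's lemma delivers maximal elements and a
    minimal one is wanted.\<close>
  let ?R = "\<lambda>h k :: 'a \<Rightarrow> real. k \<le> h"
  have "\<exists>m\<in>?A. \<forall>a\<in>?A. ?R m a \<longrightarrow> a = m"
  proof (rule predicate_Zorn)
    show "partial_order_on ?A (relation_of ?R ?A)"
      by (auto simp: partial_order_on_def preorder_on_def refl_on_def trans_def antisym_def
          relation_of_def)
  next
    fix S assume "S \<in> Chains (relation_of ?R ?A)"
    then have S: "\<And>h k. h \<in> S \<Longrightarrow> k \<in> S \<Longrightarrow> h \<in> ?A \<and> k \<in> ?A \<and> (h \<le> k \<or> k \<le> h)"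
      by (auto simp: Chains_def relation_of_def)
    show "\<exists>u\<in>?A. \<forall>h\<in>S. u \<le> h"
    proof (cases "S = {}")
      case True
      then show ?thesis
        using p by auto
    next
      case False
      obtain q where "sublinear q" "\<And>h. h \<in> S \<Longrightarrow> q \<le> h"
        using sublinear_chain_lower_bound[OF False] S by blast
      moreover obtain h where "h \<in> S"
        using False by blast
      ultimately show ?thesis
        using S[of h h] by (intro bexI[of _ q]) (auto intro: order_trans)
    qed
  qed
  then obtain \<phi> where \<phi>: "\<phi> \<in> ?A" "\<And>h. h \<in> ?A \<Longrightarrow> h \<le> \<phi> \<Longrightarrow> h = \<phi>"
    by blast
  have "linear \<phi>"
    using \<phi> by (intro minimal_sublinear_imp_linear) (auto intro: order_trans)
  then show ?thesis
    using \<phi> that by blast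
qed

section \<open>Separation and reflexivity\<close>

lemma sublinear_norm: "sublinear (norm :: 'a::real_normed_vector \<Rightarrow> real)"
  by (rule sublinearI) (auto intro: norm_triangle_ineq)

text \<open>Translating \<open>x\<close> to the origin, the norm is at least the distance
  \<open>d\<close> on the translated set. A linear minorant of the resulting \<open>q\<close> lies
  below the norm, hence is continuous, and keeps the gap \<open>d\<close>.\<close>

lemma separating_functional_exists:
  fixes C :: "'a::real_normed_vector set"
  assumes C: "closed C" "convex C" "C \<noteq> {}" and x: "x \<notin> C"
  obtains f :: "'a \<Rightarrow>\<^sub>L real" and d where "d > 0"
    "\<And>c. c \<in> C \<Longrightarrow> blinfun_apply f x + d \<le> blinfun_apply f c"
proof -
  define d where "d = infdist x C"
  have d: "d > 0"
    using C x in_closed_iff_infdist_zero[of C x] infdist_nonneg[of x C] by (auto simp: d_def)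
  have dist: "d \<le> norm c" if "c \<in> (\<lambda>c. c - x) ` C" for c
    using that infdist_le[of _ C x] by (auto simp: d_def dist_norm norm_minus_commute)
  have "convex ((\<lambda>c. c - x) ` C)" "(\<lambda>c. c - x) ` C \<noteq> {}"
    using C by (auto simp: convex_translation_subtract)
  then obtain q where q: "sublinear q" "q \<le> norm" "\<And>c. c \<in> (\<lambda>c. c - x) ` C \<Longrightarrow> q (- c) \<le> - d"
    using sublinear_minorant_exists[OF sublinear_norm _ _ dist] by blast
  obtain \<phi> where \<phi>: "linear \<phi>" "\<phi> \<le> q"
    by (rule linear_minorant_exists[OF q(1)])
  have \<phi>_le: "\<phi> y \<le> norm y" for y
    using le_funD[OF \<phi>(2), of y] le_funD[OF q(2), of y] by linarith
  have "norm (\<phi> y) \<le> norm y * 1" for y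
    using \<phi>_le[of y] \<phi>_le[of "- y"] linear_neg[OF \<phi>(1), of y] by (auto simp: abs_le_iff)
  then have "bounded_linear \<phi>"
    by (intro bounded_linear_intro[of _ 1] linear_add[OF \<phi>(1)] linear_cmul[OF \<phi>(1)])
  then have f: "blinfun_apply (Blinfun \<phi>) = \<phi>"
    by (rule bounded_linear_Blinfun_apply)
  have "blinfun_apply (Blinfun \<phi>) x + d \<le> blinfun_apply (Blinfun \<phi>) c" if "c \<in> C" for c
  proof -
    have "\<phi> (- (c - x)) \<le> - d"
      using le_funD[OF \<phi>(2), of "- (c - x)"] q(3)[of "c - x"] that by auto
    then show ?thesis
      by (simp add: f linear_diff[OF \<phi>(1)])
  qed
  then show ?thesis
    using that d by blast
qed

section \<open>Support functions and intersections of chains\<close>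

definition support_fun :: "'a::real_normed_vector set \<Rightarrow> ('a \<Rightarrow>\<^sub>L real) \<Rightarrow> real" where
  "support_fun C f = (SUP c\<in>C. blinfun_apply f c)"

text \<open>This makes the real supremum in \<open>support_fun\<close> meaningful for bounded
  sets.\<close>

lemma bdd_above_blinfun_image:
  fixes f :: "'a::real_normed_vector \<Rightarrow>\<^sub>L real"
  assumes "bounded C"
  shows "bdd_above (blinfun_apply f ` C)"
  using bounded_linear_image[OF assms blinfun.bounded_linear_right, of f]
  by (rule bounded_imp_bdd_above)

lemma support_fun_upper: "bounded C \<Longrightarrow> c \<in> C \<Longrightarrow> blinfun_apply f c \<le> support_fun C f"
  unfolding support_fun_def by (intro cSUP_upper bdd_above_blinfun_image)

lemma support_fun_least:
  "C \<noteq> {} \<Longrightarrow> (\<And>c. c \<in> C \<Longrightarrow> blinfun_apply f c \<le> u) \<Longrightarrow> support_fun C f \<le> u"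
  unfolding support_fun_def by (rule cSUP_least)

lemma support_fun_mono: "C \<noteq> {} \<Longrightarrow> C \<subseteq> D \<Longrightarrow> bounded D \<Longrightarrow> support_fun C \<le> support_fun D"
  by (auto intro!: le_funI support_fun_least support_fun_upper)

lemma sublinear_support_fun:
  assumes "C \<noteq> {}" "bounded C"
  shows "sublinear (support_fun C)"
proof (rule sublinearI)
  fix f g :: "'a \<Rightarrow>\<^sub>L real"
  show "support_fun C (f + g) \<le> support_fun C f + support_fun C g"
    using assms by (intro support_fun_least)
      (auto simp: blinfun.add_left intro!: add_mono support_fun_upper)
next
  fix t :: real and f :: "'a \<Rightarrow>\<^sub>L real" assume "t > 0"
  then show "support_fun C (t *\<^sub>R f) \<le> t * support_fun C f"
    using assms by (intro support_fun_least)
      (auto simp: blinfun.scaleR_left intro!: mult_left_mono support_fun_upper)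
qed

text \<open>The support functions of the sets form a chain on the dual space. A linear functional
  below all of them is an element of the bidual, and the point representing it lies in every
  set.\<close>

lemma reflexive_chain_Inter_nonempty:
  fixes \<C> :: "'a::real_normed_vector set set"
  assumes refl: "reflexive_space TYPE('a)"
    and \<C>: "\<C> \<noteq> {}"
      "\<And>C. C \<in> \<C> \<Longrightarrow> C \<noteq> {} \<and> closed C \<and> bounded C \<and> convex C"
    and chain: "\<And>C D. C \<in> \<C> \<Longrightarrow> D \<in> \<C> \<Longrightarrow> C \<subseteq> D \<or> D \<subseteq> C"
  shows "\<Inter>\<C> \<noteq> {}"
proof -
  obtain q where q: "sublinear q" "\<And>h. h \<in> support_fun ` \<C> \<Longrightarrow> q \<le> h"
  proof (rule sublinear_chain_lower_bound)
    show "support_fun ` \<C> \<noteq> {}"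
      using \<C>(1) by simp
    show "sublinear h" if "h \<in> support_fun ` \<C>" for h
      using that \<C>(2) by (auto intro: sublinear_support_fun)
    show "h \<le> k \<or> k \<le> h" if hk: "h \<in> support_fun ` \<C>" "k \<in> support_fun ` \<C>" for h k
    proof -
      obtain C D where CD: "C \<in> \<C>" "D \<in> \<C>" "h = support_fun C" "k = support_fun D"
        using hk by blast
      then show ?thesis
        using chain[OF CD(1,2)] \<C>(2)[OF CD(1)] \<C>(2)[OF CD(2)] support_fun_mono by blast
    qed
  qed blast
  obtain \<phi> where \<phi>: "linear \<phi>" "\<phi> \<le> q"
    by (rule linear_minorant_exists[OF q(1)])
  have \<phi>_le: "\<phi> f \<le> support_fun C f" if "C \<in> \<C>" for C f
    using le_funD[OF \<phi>(2), of f] le_funD[OF q(2), of "support_fun C" f] that by auto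
  \<comment> \<open>A norm bound for a single member of the chain already gives continuity of
    \<open>\<phi>\<close>.\<close>
  obtain C0 M where C0: "C0 \<in> \<C>" and M: "\<And>c. c \<in> C0 \<Longrightarrow> norm c \<le> M"
    using \<C> by (metis bounded_iff ex_in_conv)
  have bound: "\<phi> f \<le> norm f * M" for f
  proof -
    have "support_fun C0 f \<le> norm f * M"
    proof (rule support_fun_least)
      show "C0 \<noteq> {}"
        using \<C>(2) C0 by blast
      show "blinfun_apply f c \<le> norm f * M" if "c \<in> C0" for c
      proof -
        have "blinfun_apply f c \<le> norm f * norm c"
          using norm_blinfun[of f c] by simp
        also have "\<dots> \<le> norm f * M"
          using M[OF that] by (intro mult_left_mono) auto
        finally show ?thesis .
      qed
    qed
    then show ?thesis
      using \<phi>_le[OF C0, of f] by linarith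
  qed
  have "norm (\<phi> f) \<le> norm f * M" for f
    using bound[of f] bound[of "- f"] linear_neg[OF \<phi>(1), of f] by (auto simp: abs_le_iff)
  then have "bounded_linear \<phi>"
    by (intro bounded_linear_intro[of _ M] linear_add[OF \<phi>(1)] linear_cmul[OF \<phi>(1)])
  then have "blinfun_apply (Blinfun \<phi>) = \<phi>"
    by (rule bounded_linear_Blinfun_apply)
  moreover obtain x :: 'a where "bidual_embedding x = Blinfun \<phi>"
    using refl unfolding reflexive_space_def by (metis surjD)
  ultimately have x: "\<phi> f = blinfun_apply f x" for f
    by (metis blinfun_apply_bidual_embedding)
  have "x \<in> C" if C: "C \<in> \<C>" for C
  proof (rule ccontr)
    assume "x \<notin> C"
    then obtain f :: "'a \<Rightarrow>\<^sub>L real" and d where f: "d > 0"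
      "\<And>c. c \<in> C \<Longrightarrow> blinfun_apply f x + d \<le> blinfun_apply f c"
      using separating_functional_exists \<C>(2)[OF C] by metis
    \<comment> \<open>The separation puts \<open>x\<close> below \<open>C\<close>, whereas support
      functions bound from above; hence the sign change.\<close>
    have "support_fun C (- f) \<le> - (blinfun_apply f x + d)"
      using f(2) \<C>(2)[OF C] by (intro support_fun_least) (auto simp: blinfun.minus_left simp del: minus_add_distrib)
    then show False
      using \<phi>_le[OF C, of "- f"] f(1) by (simp add: x blinfun.minus_left)
  qed
  then show ?thesis
    by blast
qed

section \<open>The minimal time function\<close>

text \<open>For \<open>t > 0\<close> hitting becomes a condition on the target point through an
  affine map, so closedness and convexity of \<open>F\<close> carry over to the set of admissible
  \<open>w\<close>.\<close>

lemma gball_meets_iff: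
  fixes F :: "'a::real_vector set"
  assumes "t > 0"
  shows "gball F x t \<inter> Q \<noteq> {} \<longleftrightarrow> (\<exists>w\<in>Q. (1 / t) *\<^sub>R (w - x) \<in> F)"
proof
  assume "gball F x t \<inter> Q \<noteq> {}"
  then show "\<exists>w\<in>Q. (1 / t) *\<^sub>R (w - x) \<in> F"
    using assms by (force simp: gball_def)
next
  assume "\<exists>w\<in>Q. (1 / t) *\<^sub>R (w - x) \<in> F"
  then obtain w where w: "w \<in> Q" "(1 / t) *\<^sub>R (w - x) \<in> F"
    by blast
  then have "w \<in> gball F x t"
    using assms by (auto simp: gball_def intro!: image_eqI[of _ _ "(1 / t) *\<^sub>R (w - x)"])
  then show "gball F x t \<inter> Q \<noteq> {}"
    using w by blast
qed

text \<open>For \<open>t > 0\<close>, \<open>s *\<^sub>R f\<close> equals \<open>t\<close> times the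
  convex combination of \<open>f\<close> and 0 with weight \<open>s / t\<close> on
  \<open>f\<close>.\<close>

lemma gball_mono:
  assumes F: "convex F" "0 \<in> F" and t: "0 \<le> s" "s \<le> t"
  shows "gball F x s \<subseteq> gball F x t"
proof (cases "t = 0")
  case True
  then show ?thesis
    using t by simp
next
  case False
  show ?thesis
  proof
    fix y assume "y \<in> gball F x s"
    then obtain f where f: "f \<in> F" "y = x + s *\<^sub>R f"
      by (auto simp: gball_def)
    have "(s / t) *\<^sub>R f + (1 - s / t) *\<^sub>R 0 \<in> F"
      using F f t False by (intro convexD) auto
    then show "y \<in> gball F x t"
      using f False by (auto simp: gball_def intro!: image_eqI[of _ _ "(s / t) *\<^sub>R f"])
  qed
qed

lemma minimal_time_nonneg: "0 \<le> minimal_time F Q x"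
  unfolding minimal_time_def by (rule Inf_greatest) auto

lemma minimal_time_le: "0 \<le> t \<Longrightarrow> gball F x t \<inter> Q \<noteq> {} \<Longrightarrow> minimal_time F Q x \<le> ereal t"
  unfolding minimal_time_def by (rule Inf_lower) auto

lemma minimal_time_less_imp_meets:
  assumes F: "convex F" "0 \<in> F" and "minimal_time F Q x < ereal t"
  shows "gball F x t \<inter> Q \<noteq> {}"
proof -
  have "\<exists>s. 0 \<le> s \<and> gball F x s \<inter> Q \<noteq> {} \<and> s < t"
    using assms(3) unfolding minimal_time_def Inf_less_iff by fastforce
  then obtain s where "0 \<le> s" "s < t" "gball F x s \<inter> Q \<noteq> {}"
    by blast
  then show ?thesis
    using gball_mono[OF F, of s t x] by auto
qed

lemma minimal_time_finite:
  fixes F :: "'a::real_normed_vector set"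
  assumes F: "0 \<in> interior F" and Q: "Q \<noteq> {}"
  shows "minimal_time F Q x < \<infinity>"
proof -
  obtain e where e: "e > 0" "cball 0 e \<subseteq> F"
    using F by (auto simp: mem_interior_cball)
  obtain w where w: "w \<in> Q"
    using Q by blast
  \<comment> \<open>The quotient makes the dilated ball of radius \<open>e\<close> reach
    \<open>w\<close>; adding 1 keeps \<open>t\<close> positive even if \<open>w = x\<close>.\<close>
  define t where "t = norm (w - x) / e + 1"
  have t: "t > 0"
    using e by (auto simp: t_def intro!: add_nonneg_pos)
  have "norm (w - x) \<le> t * e"
    using e by (simp add: t_def field_simps)
  then have "(1 / t) *\<^sub>R (w - x) \<in> cball 0 e"
    using t by (simp add: divide_le_eq mult.commute)
  then have "gball F x t \<inter> Q \<noteq> {}"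
    using gball_meets_iff[OF t] w e(2) by blast
  then have "minimal_time F Q x \<le> ereal t"
    using t by (intro minimal_time_le) auto
  then show ?thesis
    by (auto simp: less_top[symmetric])
qed

text \<open>Each \<open>t > r\<close> admits a hitting point, and the sets \<open>C t\<close> of
  such points are nested, so reflexivity yields one point for all \<open>t > r\<close>. The case
  \<open>r = 0\<close> is included.\<close>

lemma minimal_time_le_imp_point:
  fixes F Q :: "'a::real_normed_vector set"
  assumes refl: "reflexive_space TYPE('a)"
    and F: "closed F" "convex F" "0 \<in> F"
    and Q: "closed Q" "bounded Q" "convex Q"
    and r: "0 \<le> r" "minimal_time F Q x \<le> ereal r"
  obtains w where "w \<in> Q" "\<And>t. t > r \<Longrightarrow> (1 / t) *\<^sub>R (w - x) \<in> F"
proof -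
  define C where "C t = {w \<in> Q. (1 / t) *\<^sub>R (w - x) \<in> F}" for t
  have C_eq: "C t = Q \<inter> (\<lambda>w. (1 / t) *\<^sub>R (w - x)) -` F" for t
    by (auto simp: C_def)
  have mono: "C s \<subseteq> C t" if st: "r < s" "s \<le> t" for s t
  proof
    fix w assume w: "w \<in> C s"
    \<comment> \<open>Passing from \<open>s\<close> to \<open>t\<close> shrinks the vector towards
      0, which lies in \<open>F\<close>.\<close>
    have "(s / t) *\<^sub>R ((1 / s) *\<^sub>R (w - x)) + (1 - s / t) *\<^sub>R 0 \<in> F"
      using w st r F by (intro convexD) (auto simp: C_def)
    then show "w \<in> C t"
      using w st r by (auto simp: C_def)
  qed
  have "\<Inter>(C ` {r<..}) \<noteq> {}"
  proof (rule reflexive_chain_Inter_nonempty[OF refl])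
    fix D assume "D \<in> C ` {r<..}"
    then obtain t where t: "t > r" "D = C t"
      by auto
    have "minimal_time F Q x < ereal t"
      using r(2) t(1) by (simp add: order_le_less_trans)
    then have "D \<noteq> {}"
      using minimal_time_less_imp_meets[OF F(2,3)] gball_meets_iff[of t F x Q] t r
      by (auto simp: C_def)
    moreover have "closed D"
      unfolding t C_eq using F Q by (intro closed_Int closed_vimage) (auto intro!: continuous_intros)
    moreover have "bounded D"
      using Q by (auto simp: t C_def intro: bounded_subset)
    moreover have "convex D"
      unfolding t C_def
    proof (rule convexI, clarify, intro conjI)
      fix a b and u v :: real
      assume ab: "a \<in> Q" "b \<in> Q" "(1 / t) *\<^sub>R (a - x) \<in> F" "(1 / t) *\<^sub>R (b - x) \<in> F"
        and uv: "0 \<le> u" "0 \<le> v" "u + v = 1"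
      show "u *\<^sub>R a + v *\<^sub>R b \<in> Q"
        using Q ab uv by (intro convexD)
      have "u *\<^sub>R (1 / t) *\<^sub>R (a - x) + v *\<^sub>R (1 / t) *\<^sub>R (b - x)
          = (1 / t) *\<^sub>R (u *\<^sub>R a + v *\<^sub>R b - (u + v) *\<^sub>R x)"
        by (simp add: algebra_simps)
      then show "(1 / t) *\<^sub>R (u *\<^sub>R a + v *\<^sub>R b - x) \<in> F"
        using convexD[OF F(2) ab(3,4) uv] uv by simp
    qed
    ultimately show "D \<noteq> {} \<and> closed D \<and> bounded D \<and> convex D"
      by blast
  next
    fix D E assume "D \<in> C ` {r<..}" "E \<in> C ` {r<..}"
    then show "D \<subseteq> E \<or> E \<subseteq> D"
      using mono by (auto simp: image_iff) (meson linear subsetD)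
  qed auto
  then obtain w where "\<And>t. t > r \<Longrightarrow> w \<in> C t"
    by blast
  \<comment> \<open>Some \<open>t > r\<close> has to be named to extract \<open>w \<in> Q\<close>
    from membership in the sets \<open>C t\<close>.\<close>
  then show ?thesis
    using that[of w] gt_ex[of r] by (auto simp: C_def)
qed

text \<open>The point \<open>w\<close> stays fixed while \<open>t\<close> decreases to
  \<open>r\<close>; as \<open>r > 0\<close>, the vectors \<open>(1 / t) *\<^sub>R (w - x)\<close>
  converge and closedness of \<open>F\<close> applies.\<close>

lemma minimal_time_le_imp_meets:
  fixes F Q :: "'a::real_normed_vector set"
  assumes "reflexive_space TYPE('a)"
    and F: "closed F" "convex F" "0 \<in> F"
    and "closed Q" "bounded Q" "convex Q"
    and r: "0 < r" "minimal_time F Q x \<le> ereal r"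
  shows "gball F x r \<inter> Q \<noteq> {}"
proof -
  obtain w where w: "w \<in> Q" "\<And>t. t > r \<Longrightarrow> (1 / t) *\<^sub>R (w - x) \<in> F"
    using minimal_time_le_imp_point[OF assms(1-7) less_imp_le[OF r(1)] r(2)] by blast
  have "((\<lambda>t. (1 / t) *\<^sub>R (w - x)) \<longlongrightarrow> (1 / r) *\<^sub>R (w - x)) (at_right r)"
    using r by (intro tendsto_intros) auto
  moreover have "\<forall>\<^sub>F t in at_right r. (1 / t) *\<^sub>R (w - x) \<in> F"
    using w(2) by (auto simp: eventually_at_right_field intro: exI[of _ "r + 1"])
  ultimately have "(1 / r) *\<^sub>R (w - x) \<in> F"
    using Lim_in_closed_set[OF F(1)] by (metis trivial_limit_at_right_real)
  then show ?thesis
    using gball_meets_iff[OF r(1)] w(1) by blast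
qed

text \<open>At time zero the limit argument is replaced by the substitution of \<open>1 / t\<close>
  for \<open>t\<close>: the whole ray from 0 in the direction \<open>w - x\<close> lies in
  \<open>F\<close>.\<close>

lemma minimal_time_le_zero_imp_cone:
  fixes F Q :: "'a::real_normed_vector set"
  assumes "reflexive_space TYPE('a)"
    and F: "closed F" "convex F" "0 \<in> F"
    and "closed Q" "bounded Q" "convex Q"
    and r: "minimal_time F Q x \<le> 0"
  shows "x \<in> {w - d | w d. w \<in> Q \<and> d \<in> asymptotic_cone F}"
proof -
  obtain w where w: "w \<in> Q" "\<And>t. t > 0 \<Longrightarrow> (1 / t) *\<^sub>R (w - x) \<in> F"
    using minimal_time_le_imp_point[OF assms(1-7), of 0 x] r by (auto simp: zero_ereal_def)
  have "t *\<^sub>R (w - x) \<in> F" if "t > 0" for t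
    using w(2)[of "1 / t"] that by simp
  then have "w - x \<in> asymptotic_cone F"
    using F(3) by (auto simp: asymptotic_cone_def intro!: bexI[of _ 0])
  moreover have "x = w - (w - x)"
    by simp
  ultimately show ?thesis
    using w(1) by blast
qed

section \<open>Maximum of the minimal times and the equivalence\<close>

lemma max_time_le_iff:
  "m \<ge> 1 \<Longrightarrow> max_time F m \<Omega>s x \<le> u \<longleftrightarrow> (\<forall>i\<in>{1..m}. minimal_time F (\<Omega>s i) x \<le> u)"
  unfolding max_time_def by (subst Max_le_iff) auto

lemma max_time_less_iff:
  "m \<ge> 1 \<Longrightarrow> max_time F m \<Omega>s x < u \<longleftrightarrow> (\<forall>i\<in>{1..m}. minimal_time F (\<Omega>s i) x < u)"
  unfolding max_time_def by (subst Max_less_iff) auto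

lemma max_time_nonneg:
  assumes "m \<ge> 1"
  shows "0 \<le> max_time F m \<Omega>s x"
proof -
  have "minimal_time F (\<Omega>s 1) x \<le> max_time F m \<Omega>s x"
    using assms max_time_le_iff[OF assms, of F \<Omega>s x "max_time F m \<Omega>s x"] by auto
  then show ?thesis
    using minimal_time_nonneg order_trans by blast
qed

theorem theorem5p1:
  fixes F \<Omega> :: "'a::banach set" and \<Omega>s :: "nat \<Rightarrow> 'a set"
    and m :: nat and x :: 'a and r :: ereal
  assumes "reflexive_space TYPE('a)"
    and "closed F" "convex F" "0 \<in> interior F"
    and "m \<ge> 1"
    and "\<Omega> \<noteq> {}" "closed \<Omega>" "bounded \<Omega>" "convex \<Omega>"
    and "\<And>i. i \<in> {1..m} \<Longrightarrow>
           \<Omega>s i \<noteq> {} \<and> closed (\<Omega>s i) \<and> bounded (\<Omega>s i) \<and> convex (\<Omega>s i)"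
    and "\<Omega> \<inter> (\<Inter>i\<in>{1..m}. {w - d | w d. w \<in> \<Omega>s i \<and> d \<in> asymptotic_cone F}) = {}"
  shows "(is_arg_min (max_time F m \<Omega>s) (\<lambda>y. y \<in> \<Omega>) x \<and> r = max_time F m \<Omega>s x) \<longleftrightarrow>
         (\<exists>\<rho>::real. r = ereal \<rho> \<and> sib_solution F \<Omega> m \<Omega>s x \<rho>)"
proof -
  let ?T = "max_time F m \<Omega>s"
  let ?meets = "\<lambda>y t. \<forall>i\<in>{1..m}. gball F y t \<inter> \<Omega>s i \<noteq> {}"
  note refl = assms(1) and m = assms(5) and \<Omega>s = assms(10)
  have F: "closed F" "convex F" "0 \<in> F"
    using assms(2-4) interior_subset by auto
  \<comment> \<open>Finiteness allows extended-real values to be compared with real radii; it rests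
    on 0 being interior to \<open>F\<close>.\<close>
  have finite: "\<exists>\<rho>\<ge>0. ?T y = ereal \<rho>" for y
  proof -
    have "?T y < \<infinity>"
      unfolding max_time_less_iff[OF m] using minimal_time_finite[OF assms(4)] \<Omega>s by blast
    then show ?thesis
      using max_time_nonneg[OF m, of F \<Omega>s y] by (cases "?T y") auto
  qed
  \<comment> \<open>The disjointness hypothesis enters here: time zero for all targets would place
    \<open>y\<close> in every set that is intersected with \<open>\<Omega>\<close>.\<close>
  have positive: "\<not> ?T y \<le> 0" if y: "y \<in> \<Omega>" for y
  proof
    assume "?T y \<le> 0"
    then have "y \<in> {w - d | w d. w \<in> \<Omega>s i \<and> d \<in> asymptotic_cone F}" if "i \<in> {1..m}" for i
      using that \<Omega>s[OF that] by (intro minimal_time_le_zero_imp_cone[OF refl F])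
        (auto simp: max_time_le_iff[OF m])
    then show False
      using y assms(11) by blast
  qed
  have le_iff: "?T y \<le> ereal t \<longleftrightarrow> ?meets y t" if y: "y \<in> \<Omega>" and t: "t \<ge> 0" for y t
  proof
    assume le: "?T y \<le> ereal t"
    \<comment> \<open>At \<open>t = 0\<close> the infimum need not be attained, so this case has to
      be excluded first.\<close>
    with positive[OF y] t have "t > 0"
      by (cases "t = 0") (auto simp: zero_ereal_def)
    then show "?meets y t"
      using le \<Omega>s by (intro ballI minimal_time_le_imp_meets[OF refl F])
        (auto simp: max_time_le_iff[OF m])
  next
    assume "?meets y t"
    then show "?T y \<le> ereal t"
      unfolding max_time_le_iff[OF m] using t minimal_time_le by blast
  qed
  show ?thesis
  proof
    assume L: "is_arg_min ?T (\<lambda>y. y \<in> \<Omega>) x \<and> r = ?T x"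
    then have x: "x \<in> \<Omega>" "\<And>y. y \<in> \<Omega> \<Longrightarrow> ?T x \<le> ?T y"
      by (auto simp: is_arg_min_def not_less)
    obtain \<rho> where \<rho>: "\<rho> \<ge> 0" "?T x = ereal \<rho>"
      using finite by blast
    have "?meets x \<rho>"
      using le_iff[OF x(1) \<rho>(1)] \<rho>(2) by simp
    moreover have "\<rho> \<le> t" if "y \<in> \<Omega>" "t \<ge> 0" "?meets y t" for y t
    proof -
      have "?T y \<le> ereal t"
        using le_iff that by blast
      then have "ereal \<rho> \<le> ereal t"
        using x(2)[OF that(1)] \<rho>(2) by (metis order_trans)
      then show ?thesis
        by simp
    qed
    ultimately have "sib_solution F \<Omega> m \<Omega>s x \<rho>"
      unfolding sib_solution_def using x(1) \<rho>(1) by blast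
    then show "\<exists>\<rho>. r = ereal \<rho> \<and> sib_solution F \<Omega> m \<Omega>s x \<rho>"
      using L \<rho>(2) by auto
  next
    assume "\<exists>\<rho>. r = ereal \<rho> \<and> sib_solution F \<Omega> m \<Omega>s x \<rho>"
    then obtain \<rho> where r: "r = ereal \<rho>" and x: "x \<in> \<Omega>" "\<rho> \<ge> 0" "?meets x \<rho>"
      and least: "\<And>y t. y \<in> \<Omega> \<Longrightarrow> t \<ge> 0 \<Longrightarrow> ?meets y t \<Longrightarrow> \<rho> \<le> t"
      unfolding sib_solution_def by blast
    \<comment> \<open>The value at \<open>y\<close> is itself a feasible radius for
      \<open>y\<close>, by attainment, so minimality of \<open>\<rho>\<close> among feasible radii
      applies to it.\<close>
    have lower: "ereal \<rho> \<le> ?T y" if y: "y \<in> \<Omega>" for y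
    proof -
      obtain t where t: "t \<ge> 0" "?T y = ereal t"
        using finite by blast
      then have "?meets y t"
        using le_iff[OF y t(1)] by simp
      then show ?thesis
        using least[OF y t(1)] t(2) by simp
    qed
    have "?T x = ereal \<rho>"
      using le_iff[OF x(1,2)] x(3) lower[OF x(1)] by (intro antisym) auto
    then show "is_arg_min ?T (\<lambda>y. y \<in> \<Omega>) x \<and> r = ?T x"
      using x(1) lower r by (auto simp: is_arg_min_def not_less)
  qed
qed

end
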